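(* Every finite simple cubic claw-free graph with fewer than $114$ vertices contains a cycle whose length is a power of $2$. Equivalently, any cubic claw-free counterexample to the Erd\H{o}s-Gy\'{a}rf\'{a}s conjecture must have at least $114$ vertices.
   Context: A graph is cubic if every vertex has degree $3$, and claw-free if it does not contain $K_{1,3}$ as an induced subgraph. The Erd\H{o}s-Gy\'{a}rf\'{a}s conjecture states that every graph with minimum degree at least three has a cycle whose length is a power of $2$. *)

theory Defs
  imports "Graph_Theory.Graph_Theory"
begin

text \<open>
  A finite simple undirected graph is a finite symmetric digraph without loops and without
  parallel arcs (the locale predicate \<^const>\<open>graph\<close>): an edge between \<open>u\<close> and \<open>v\<close> is
  represented by exactly one arc in each direction. Hence the degree of a vertex is its
  out-degree.
\<close>

definition cubic :: "('a, 'b) pre_digraph \<Rightarrow> bool" where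
  "cubic G \<longleftrightarrow> (\<forall>v \<in> verts G. out_degree G v = 3)"

definition claw_free :: "('a, 'b) pre_digraph \<Rightarrow> bool" where
  "claw_free G \<longleftrightarrow> \<not> (\<exists>H. induced_subgraph H G \<and> complete_bipartite_digraph 1 3 H)"

text \<open>
  In a symmetric digraph an edge traversed back and forth is a directed cycle of length 2.
  The directed cycles of length at least 3 are exactly the cycles of the undirected graph.
\<close>

definition undirected_cycle :: "('a, 'b) pre_digraph \<Rightarrow> 'b awalk \<Rightarrow> bool" where
  "undirected_cycle G p \<longleftrightarrow> pre_digraph.cycle G p \<and> 3 \<le> length p"

definition has_power_of_2_cycle :: "('a, 'b) pre_digraph \<Rightarrow> bool" where
  "has_power_of_2_cycle G \<longleftrightarrow> (\<exists>p k. undirected_cycle G p \<and> length p = 2 ^ k)"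

text \<open>
  Graphs are nonempty by convention; the null graph would satisfy the degree condition
  vacuously and has no cycle.
\<close>

definition erdos_gyarfas_counterexample :: "('a, 'b) pre_digraph \<Rightarrow> bool" where
  "erdos_gyarfas_counterexample G \<longleftrightarrow>
     graph G \<and> verts G \<noteq> {} \<and> (\<forall>v \<in> verts G. 3 \<le> out_degree G v) \<and> \<not> has_power_of_2_cycle G"

end

theory Submission
  imports Defs
begin

text \<open>
  Without a 4-cycle, claw-freeness makes every vertex of a cubic graph lie in exactly one triangle,
  with its third edge leading to another triangle. Contracting the triangles yields a cubic graph
  \<open>H\<close> with a third of the vertices. A cycle of length \<open>k\<close> in \<open>H\<close> passes each of its triangles along
  one or two edges, so it lifts to cycles of all lengths from \<open>2 k\<close> to \<open>3 k\<close>. As the lengths 8 and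
  16 do not occur, \<open>H\<close> has no cycles of length 3, 4, 6, 7 or 8.

  Such an \<open>H\<close> has at least 40 vertices by a Moore-type count. Without 5-cycles its girth is at
  least 9 and a ball of radius 4 has 46 vertices. Otherwise hang a binary tree of depth 2 on the
  outer neighbour of every vertex of a 5-cycle: these trees are disjoint, since where two of them
  meet, the two arcs of the 5-cycle close up two cycles, one of which has a forbidden length. This
  gives \<open>5 * 8 = 40\<close> vertices, even more than the 38 required.
\<close>

subsection \<open>Cycles and non-backtracking walks\<close>

definition is_cycle :: "('v \<Rightarrow> 'v \<Rightarrow> bool) \<Rightarrow> 'v list \<Rightarrow> bool" where
  "is_cycle E xs \<longleftrightarrow>
     3 \<le> length xs \<and> distinct xs \<and> successively E xs \<and> E (last xs) (hd xs)"

text \<open>Vertices may repeat, but no step is undone at once. This local condition survives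
  cutting and joining; distinctness is recovered later from a lower bound on cycle lengths.\<close>

fun nonbacktracking :: "('v \<Rightarrow> 'v \<Rightarrow> bool) \<Rightarrow> 'v list \<Rightarrow> bool" where
  "nonbacktracking E [] \<longleftrightarrow> True"
| "nonbacktracking E [x] \<longleftrightarrow> True"
| "nonbacktracking E [x, y] \<longleftrightarrow> E x y"
| "nonbacktracking E (x # y # z # zs) \<longleftrightarrow> E x y \<and> x \<noteq> z \<and> nonbacktracking E (y # z # zs)"

lemma nonbacktracking_successively:
  "nonbacktracking E xs \<Longrightarrow> successively E xs"
  by (induction E xs rule: nonbacktracking.induct) auto

lemma nonbacktracking_prefix:
  "nonbacktracking E (xs @ ys) \<Longrightarrow> nonbacktracking E xs"
proof (induction E xs rule: nonbacktracking.induct)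
  case (3 E x y)
  then show ?case by (cases ys) auto
qed auto

lemma nonbacktracking_join:
  assumes "nonbacktracking E (xs @ [w])" "nonbacktracking E (w # ys)"
    and "xs \<noteq> [] \<Longrightarrow> ys \<noteq> [] \<Longrightarrow> last xs \<noteq> hd ys"
  shows "nonbacktracking E (xs @ w # ys)"
  using assms
proof (induction E xs rule: nonbacktracking.induct)
  case (2 E x)
  then show ?case by (cases ys) auto
next
  case (3 E x y)
  then show ?case by (cases ys) auto
qed auto

lemma nonbacktracking_if_distinct:
  "distinct xs \<Longrightarrow> successively E xs \<Longrightarrow> nonbacktracking E xs"
  by (induction E xs rule: nonbacktracking.induct) auto

text \<open>Extending the cycle by one vertex at either end gives each of its vertices a predecessor
  and a successor, as \<open>lift_path\<close> needs for the end triangles.\<close>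

lemma nonbacktracking_closed:
  assumes "is_cycle E cs"
  shows "nonbacktracking E (last cs # cs @ [hd cs])"
proof -
  obtain a cs' where cs: "cs = a # cs'" using assms by (cases cs) (auto simp: is_cycle_def)
  moreover have "cs' \<noteq> []" using assms cs by (auto simp: is_cycle_def)
  then obtain bs z where "cs' = bs @ [z]" by (metis append_butlast_last_id)
  ultimately have cs: "cs = a # bs @ [z]" by simp
  with assms have bs: "bs \<noteq> []" and dist: "distinct (a # bs @ [z])" and "E z a"
    and nb: "nonbacktracking E (a # bs @ [z])"
    by (auto simp: is_cycle_def nonbacktracking_if_distinct)
  have "nonbacktracking E ((z # a # bs) @ z # [a])"
  proof (rule nonbacktracking_join)
    show "nonbacktracking E ((z # a # bs) @ [z])"
      using nb \<open>E z a\<close> bs dist by (cases bs) auto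
    show "last (z # a # bs) \<noteq> hd [a]" using bs dist by auto
  qed (use \<open>E z a\<close> in auto)
  then show ?thesis by (simp add: cs)
qed

text \<open>The bound 4 counts a root in \<open>C\<close>, its outer neighbour and at most two
  further steps. Only the first step must leave \<open>C\<close>; later returns are dealt with in
  \<open>no_meeting_branches\<close>.\<close>

definition branch :: "('v \<Rightarrow> 'v \<Rightarrow> bool) \<Rightarrow> 'v set \<Rightarrow> 'v list \<Rightarrow> bool" where
  "branch E C p \<longleftrightarrow> nonbacktracking E p \<and> p \<noteq> [] \<and> length p \<le> 4 \<and> hd p \<in> C
     \<and> (tl p \<noteq> [] \<longrightarrow> hd (tl p) \<notin> C)"

text \<open>Cutting a branch keeps its root, so the induction in \<open>no_meeting_branches\<close>
  can pass to shorter pairs.\<close>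

lemma branch_prefix:
  assumes "branch E C (as @ x # bs)"
  shows "branch E C (as @ [x])" "hd (as @ [x]) = hd (as @ x # bs)"
proof -
  have "nonbacktracking E (as @ [x])"
    using assms nonbacktracking_prefix[of E "as @ [x]" bs] by (simp add: branch_def)
  then show "branch E C (as @ [x])"
    using assms by (cases as) (auto simp: branch_def hd_append split: if_splits)
  show "hd (as @ [x]) = hd (as @ x # bs)" by (cases as) auto
qed

locale simple_adjacency =
  fixes E :: "'v \<Rightarrow> 'v \<Rightarrow> bool"
  assumes sym: "E u v \<Longrightarrow> E v u"
    and irrefl: "\<not> E v v"
begin

lemma nonbacktracking_rev:
  "nonbacktracking E xs \<Longrightarrow> nonbacktracking E (rev xs)"
proof (induction xs rule: induct_list012)
  case (3 x y zs)
  show ?case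
  proof (cases zs)
    case Nil
    then show ?thesis using 3 by (auto intro: sym)
  next
    case (Cons z zs')
    then have "nonbacktracking E (rev zs @ [y])" using 3 by simp
    moreover have "nonbacktracking E [y, x]" using 3(3) Cons by (auto intro: sym)
    ultimately have "nonbacktracking E (rev zs @ y # [x])"
      by (rule nonbacktracking_join) (use 3(3) Cons in auto)
    then show ?thesis by simp
  qed
qed auto

lemma successively_rev: "successively E (rev xs) \<longleftrightarrow> successively E xs"
proof -
  have "E = (\<lambda>x y. E y x)" using sym by blast
  then show ?thesis by (metis List.successively_rev)
qed

text \<open>The tail is distinct by induction. If the first vertex recurs in it, the walk up to that
  point is a cycle with fewer vertices than the walk.\<close>

lemma nonbacktracking_distinct:
  assumes "nonbacktracking E xs"
    and "\<And>cs. is_cycle E cs \<Longrightarrow> length xs \<le> length cs"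
  shows "distinct xs"
  using assms
proof (induction xs rule: induct_list012)
  case (3 x y zs)
  have tl: "nonbacktracking E (y # zs)" using 3(3) by (cases zs) auto
  have dist: "distinct (y # zs)"
    by (rule 3(2)[OF tl]) (use 3(4) in fastforce)
  have "x \<notin> set (y # zs)"
  proof
    assume "x \<in> set (y # zs)"
    then obtain as bs where split: "y # zs = as @ x # bs" by (meson split_list)
    have "E x y" using 3(3) by (cases zs) auto
    then have "x \<noteq> y" using irrefl by blast
    then obtain a as' where as: "as = a # as'" using split by (cases as) auto
    \<comment> \<open>Returning after two steps would be backtracking, so the closed stretch has at
      least three vertices.\<close>
    have "as' \<noteq> []" using 3(3) split as by (cases as') auto
    have "successively E ((x # as) @ x # bs)"
      using nonbacktracking_successively[OF 3(3)] split by simp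
    then have "successively E (x # as)" "E (last (x # as)) x"
      unfolding successively_append_iff by auto
    moreover have "distinct (x # as)" using dist split by auto
    moreover have "3 \<le> length (x # as)" using as \<open>as' \<noteq> []\<close> by (cases as') auto
    ultimately have "is_cycle E (x # as)" by (auto simp: is_cycle_def)
    from 3(4)[OF this] have "length (x # y # zs) \<le> length (x # as)" .
    then show False using arg_cong[OF split, of length] by simp
  qed
  then show ?case using dist by simp
qed auto

text \<open>Rotate the cycle to start at \<open>x\<close> and cut it at \<open>y\<close>. One arc is
  reversed, so that both run from \<open>y\<close> to \<open>x\<close> and either can close the same
  path.\<close>

lemma cycle_arcs:
  assumes "is_cycle E cs" "x \<in> set cs" "y \<in> set cs" "x \<noteq> y"
  obtains r s where "length r + length s + 2 = length cs"
    "successively E (y # r @ [x])" "distinct r" "set r \<subseteq> set cs - {x, y}"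
    "successively E (y # s @ [x])" "distinct s" "set s \<subseteq> set cs - {x, y}"
proof -
  obtain as bs where cs: "cs = as @ x # bs" using assms(2) by (meson split_list)
  have "successively E (as @ x # bs)" "E (last (as @ x # bs)) (hd (as @ x # bs))"
    using assms(1) by (auto simp: is_cycle_def cs)
  then have walk: "successively E (x # (bs @ as) @ [x])"
    by (cases "as = []"; cases "bs = []")
      (auto simp: successively_append_iff successively_Cons hd_append)
  have "y \<in> set (bs @ as)" using assms(3,4) cs by auto
  then obtain s r where split: "bs @ as = s @ y # r" by (meson split_list)
  have len: "length r + length s + 2 = length cs"
    using arg_cong[OF split, of length] cs by simp
  have "distinct (x # s @ y # r)" "set (x # s @ y # r) = set cs"
    using assms(1) split[symmetric] arg_cong[OF split, of set] by (auto simp: is_cycle_def cs)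
  then have sets: "distinct r" "set r \<subseteq> set cs - {x, y}"
    "distinct (rev s)" "set (rev s) \<subseteq> set cs - {x, y}" by auto
  have "successively E ((x # s @ [y]) @ (r @ [x]))" "successively E ((x # s) @ (y # r @ [x]))"
    using walk split by simp_all
  then have "successively E (x # s @ [y])" "successively E (y # r @ [x])"
    by (simp_all only: successively_append_iff)
  moreover have "successively E (y # rev s @ [x])"
    using successively_rev[of "x # s @ [y]"] calculation(1) by simp
  ultimately show ?thesis using that[of r "rev s"] len sets by auto
qed

section \<open>Balls as binary trees\<close>

text \<open>The vertices reached from \<open>w\<close> in at most \<open>n\<close> steps without
  backtracking after arriving from \<open>u\<close>. In a cubic graph of large girth they form a
  binary tree rooted at \<open>w\<close>.\<close>

fun ball :: "'v \<Rightarrow> 'v \<Rightarrow> nat \<Rightarrow> 'v set" where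
  "ball u w 0 = {w}"
| "ball u w (Suc n) = insert w (\<Union>x\<in>{x. E w x \<and> x \<noteq> u}. ball w x n)"

lemma ball_walk:
  assumes "y \<in> ball u w n" "E u w"
  obtains q where "nonbacktracking E (u # w # q)" "length q \<le> n" "last (w # q) = y"
  using assms
proof (induction n arbitrary: u w thesis)
  case 0
  then show ?case using 0(1)[of "[]"] by simp
next
  case (Suc n)
  show ?case
  proof (cases "y = w")
    case True
    then show ?thesis using Suc.prems(1)[of "[]"] Suc.prems(3) by auto
  next
    case False
    then obtain x where x: "E w x" "x \<noteq> u" "y \<in> ball w x n" using Suc.prems(2) by auto
    obtain q where "nonbacktracking E (w # x # q)" "length q \<le> n" "last (x # q) = y"
      using Suc.IH[OF _ x(3,1)] by blast
    then show ?thesis using Suc.prems(1)[of "x # q"] Suc.prems(3) x by auto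
  qed
qed

text \<open>A walk from \<open>w\<close> into the ball has at most \<open>n + 2\<close> vertices, so
  the girth makes it a path, which cannot return to \<open>w\<close>.\<close>

lemma root_notin_ball:
  assumes "\<And>cs. is_cycle E cs \<Longrightarrow> n + 2 \<le> length cs" "E w x"
  shows "w \<notin> ball w x n"
proof
  assume "w \<in> ball w x n"
  then obtain q where q: "nonbacktracking E (w # x # q)" "length q \<le> n" "last (x # q) = w"
    using ball_walk assms(2) by metis
  have "distinct (w # x # q)"
  proof (rule nonbacktracking_distinct[OF q(1)])
    show "length (w # x # q) \<le> length cs" if "is_cycle E cs" for cs
      using assms(1)[OF that] q(2) by simp
  qed
  then show False using q(3) by (metis distinct.simps(2) last_in_set list.distinct(1))
qed

text \<open>A common vertex would be both ends of a walk through \<open>w\<close> with at most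
  \<open>2 * n + 3\<close> vertices, which the girth forces to be a path.\<close>

lemma disjoint_balls:
  assumes girth: "\<And>cs. is_cycle E cs \<Longrightarrow> 2 * n + 3 \<le> length cs"
    and "E w x" "E w x'" "x \<noteq> x'"
  shows "ball w x n \<inter> ball w x' n = {}"
proof (rule ccontr)
  assume "ball w x n \<inter> ball w x' n \<noteq> {}"
  then obtain y where "y \<in> ball w x n" "y \<in> ball w x' n" by blast
  then obtain q q' where q: "nonbacktracking E (w # x # q)" "length q \<le> n" "last (x # q) = y"
    and q': "nonbacktracking E (w # x' # q')" "length q' \<le> n" "last (x' # q') = y"
    using ball_walk assms(2,3) by metis
  let ?c = "rev (x # q) @ w # x' # q'"
  have "nonbacktracking E ?c"
    by (rule nonbacktracking_join)
      (use nonbacktracking_rev[OF q(1)] q'(1) assms(4) in auto)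
  moreover have "length ?c \<le> length cs" if "is_cycle E cs" for cs
    using girth[OF that] q(2) q'(2) by simp
  ultimately have "distinct ?c" by (rule nonbacktracking_distinct)
  moreover have "y \<in> set (rev (x # q))" using q(3) by (metis last_in_set list.distinct(1) set_rev)
  moreover have "y \<in> set (x' # q')" using q'(3) by (metis last_in_set list.distinct(1))
  ultimately show False by auto
qed

section \<open>Branches on a 5-cycle\<close>

text \<open>A chord of a 5-cycle would cut off a triangle.\<close>

lemma five_cycle_nbrs:
  assumes "is_cycle E cs" "length cs = 5" "\<And>ds. is_cycle E ds \<Longrightarrow> length ds \<noteq> 3" "v \<in> set cs"
  obtains x y where "x \<noteq> y" "{u. E v u} \<inter> set cs = {x, y}"
proof -
  obtain a b c d e where cs: "cs = [a, b, c, d, e]"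
    using assms(2) by (auto simp: length_Suc_conv eval_nat_numeral)
  have no3: False if "E x y" "E y z" "E z x" "x \<noteq> y" "y \<noteq> z" "x \<noteq> z" for x y z
    using assms(3)[of "[x, y, z]"] that by (simp add: is_cycle_def)
  have adj: "E a b" "E b c" "E c d" "E d e" "E e a" and dist: "distinct [a, b, c, d, e]"
    using assms(1) by (auto simp: is_cycle_def cs)
  have "\<not> E c a" "\<not> E d b" "\<not> E e c" "\<not> E a d" "\<not> E b e"
    using no3[of a b c] no3[of b c d] no3[of c d e] no3[of d e a] no3[of e a b] adj dist
    by auto
  then have "{u. E a u} \<inter> set cs = {b, e}" "{u. E b u} \<inter> set cs = {a, c}"
    "{u. E c u} \<inter> set cs = {b, d}" "{u. E d u} \<inter> set cs = {c, e}"
    "{u. E e u} \<inter> set cs = {d, a}"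
    unfolding cs using adj adj[THEN sym] irrefl by (auto dest: sym)
  moreover have "v = a \<or> v = b \<or> v = c \<or> v = d \<or> v = e"
    using assms(4) unfolding cs by simp
  moreover have "b \<noteq> e" "a \<noteq> c" "b \<noteq> d" "c \<noteq> e" "d \<noteq> a" using dist by auto
  ultimately show ?thesis using that by (elim disjE) blast+
qed

text \<open>
  In a minimal counterexample, the two branches share only their last vertex and meet the 5-cycle
  only in their starting points. So together with either arc of the 5-cycle they form a cycle.
\<close>
lemma no_meeting_branches:
  assumes C: "is_cycle E cs" "length cs = 5"
    and lengths: "\<And>ds. is_cycle E ds \<Longrightarrow> length ds \<notin> {3, 4, 6, 7, 8}"
    and "branch E (set cs) p" "branch E (set cs) q" "last p = last q"
  shows "hd p = hd q"
  using assms(4-)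
proof (induction "length p + length q" arbitrary: p q rule: less_induct)
  case less
  note p = less.prems(1) and q = less.prems(2) and last = less.prems(3)
  have pq: "p \<noteq> []" "length p \<le> 4" "hd p \<in> set cs" "q \<noteq> []" "length q \<le> 4" "hd q \<in> set cs"
    "nonbacktracking E p" "nonbacktracking E q"
    using p q by (auto simp: branch_def)
  show ?case
  proof (rule ccontr)
    assume ne: "hd p \<noteq> hd q"
    have girth: "5 \<le> length ds" if "is_cycle E ds" for ds
      using lengths[OF that] that by (auto simp: is_cycle_def)
    have dist: "distinct p" "distinct q"
      using nonbacktracking_distinct[OF pq(7)] nonbacktracking_distinct[OF pq(8)] girth pq(2,5)
      by fastforce+
    define a b z where "a = butlast p" and "b = butlast q" and "z = last p"
    have pz: "p = a @ [z]" and qz: "q = b @ [z]"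
      unfolding a_def b_def z_def using pq(1,4) last append_butlast_last_id by metis+
    \<comment> \<open>At a common vertex before the end of \<open>q\<close>, both branches could be
      cut, giving a shorter pair with the same two roots.\<close>
    have disj: "set p \<inter> set b = {}"
    proof (rule ccontr)
      assume "set p \<inter> set b \<noteq> {}"
      then obtain x where "x \<in> set p" "x \<in> set b" by blast
      then obtain p1 p2 q1 q2 where p12: "p = p1 @ x # p2" and q12: "b = q1 @ x # q2"
        by (meson split_list)
      have q12': "q = q1 @ x # q2 @ [z]" using q12 qz by simp
      have "hd (p1 @ [x]) = hd (q1 @ [x])"
        using branch_prefix(1)[OF p[unfolded p12]] branch_prefix(1)[OF q[unfolded q12']]
        by (intro less.hyps) (auto simp: p12 q12')
      then show False
        using ne branch_prefix(2)[OF p[unfolded p12]] branch_prefix(2)[OF q[unfolded q12']]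
        by (simp add: p12 q12')
    qed
    have single: "branch E (set cs) [x]" if "x \<in> set cs" for x
      using that by (simp add: branch_def)
    \<comment> \<open>Compare the prefix ending at \<open>x\<close> with the one-vertex branch
      \<open>[x]\<close>. The case \<open>x = hd q\<close> has to stay, since \<open>p\<close> may
      end there when \<open>q\<close> is a single vertex.\<close>
    have avoid_p: "x = hd p \<or> x = hd q" if x: "x \<in> set cs" "x \<in> set p" for x
    proof (rule ccontr)
      assume nx: "\<not> (x = hd p \<or> x = hd q)"
      obtain p1 p2 where p12: "p = p1 @ x # p2" using split_list[OF x(2)] by blast
      have shorter: "length (p1 @ [x]) + length [x] < length p + length q"
        using nx last pq(4) unfolding p12 by (cases p2; cases q) auto
      have "hd (p1 @ [x]) = hd [x]"
        using branch_prefix(1)[OF p[unfolded p12]] single[OF x(1)] last pq(4)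
        by (intro less.hyps) (use shorter in \<open>auto simp: p12\<close>)
      then show False using nx branch_prefix(2)[OF p[unfolded p12]] by (simp add: p12)
    qed
    have avoid_q: "x = hd p \<or> x = hd q" if x: "x \<in> set cs" "x \<in> set q" for x
    proof (rule ccontr)
      assume nx: "\<not> (x = hd p \<or> x = hd q)"
      obtain q1 q2 where q12: "q = q1 @ x # q2" using split_list[OF x(2)] by blast
      have shorter: "length [x] + length (q1 @ [x]) < length p + length q"
        using nx last pq(1) unfolding q12 by (cases q2; cases p) auto
      have "hd [x] = hd (q1 @ [x])"
        using branch_prefix(1)[OF q[unfolded q12]] single[OF x(1)] last pq(1)
        by (intro less.hyps) (use shorter in \<open>auto simp: q12\<close>)
      then show False using nx branch_prefix(2)[OF q[unfolded q12]] by (simp add: q12)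
    qed
    \<comment> \<open>The second vertex lies off the 5-cycle, so coming back to it takes at least
      two steps.\<close>
    have length_ge: "3 \<le> length p'" if "branch E (set cs) p'" "hd p' \<noteq> last p'" "last p' \<in> set cs" for p'
      using that unfolding branch_def by (cases p'; cases "tl p'"; cases "tl (tl p')") auto
    have sum_ge: "4 \<le> length p + length q"
    proof -
      have "3 \<le> length q" if "length p = 1"
      proof -
        have "last p = hd p" using that by (cases p) auto
        then show ?thesis using length_ge[OF q] last ne pq(3) by metis
      qed
      moreover have "3 \<le> length p" if "length q = 1"
      proof -
        have "last q = hd q" using that by (cases q) auto
        then show ?thesis using length_ge[OF p] last ne pq(6) by metis
      qed
      moreover have "length p \<noteq> 0" "length q \<noteq> 0" using pq(1,4) by auto
      ultimately show ?thesis by linarith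
    qed
    obtain r s where rs: "length r + length s + 2 = length cs"
      "successively E (hd q # r @ [hd p])" "distinct r" "set r \<subseteq> set cs - {hd p, hd q}"
      "successively E (hd q # s @ [hd p])" "distinct s" "set s \<subseteq> set cs - {hd p, hd q}"
      using cycle_arcs[OF C(1) pq(3,6) ne] .
    \<comment> \<open>The cycle follows \<open>p\<close> to the meeting vertex, \<open>q\<close>
      backwards to its root, and an arc of the 5-cycle home.\<close>
    have cyc: "is_cycle E (p @ rev b @ r)"
      if r: "successively E (hd q # r @ [hd p])" "distinct r" "set r \<subseteq> set cs - {hd p, hd q}"
        and len: "3 \<le> length (p @ rev b @ r)" for r
    proof -
      have "successively E (z # rev b)"
        using nonbacktracking_successively[OF pq(8)] successively_rev[of q] qz by simp
      moreover have "successively E p" by (rule nonbacktracking_successively[OF pq(7)])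
      ultimately have "successively E (p @ rev b)"
        unfolding pz by (auto simp: successively_append_iff successively_Cons)
      moreover have "last (p @ rev b) = hd q" unfolding pz qz by (cases b) auto
      ultimately have "successively E ((p @ rev b) @ (r @ [hd p]))"
        using r(1) pq(1) by (subst successively_append_iff) (auto simp: successively_Cons)
      then have "successively E ((p @ rev b @ r) @ [hd p])" by simp
      then have "successively E (p @ rev b @ r)" "E (last (p @ rev b @ r)) (hd (p @ rev b @ r))"
        unfolding successively_append_iff[of E "p @ rev b @ r"] using pq(1) by auto
      moreover have "distinct (p @ rev b @ r)"
        using dist disj r(2,3) avoid_p avoid_q qz by auto
      ultimately show ?thesis using len by (simp add: is_cycle_def)
    qed
    have lens: "length (p @ rev b @ r) = length p + length q - 1 + length r" for r
      using qz by simp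
    \<comment> \<open>Let \<open>k = length p + length q - 1\<close>, between 3 and 7. If the arcs
      have 0 and 3 inner vertices, the shorter cycle must have \<open>k = 5\<close>, and the other
      has length 8. If they have 1 and 2, then \<open>k + 1 = 5\<close>, and the other has length
      6.\<close>
    have "length p + length q - 1 + length r \<notin> {3, 4, 6, 7, 8}"
      "length p + length q - 1 + length s \<notin> {3, 4, 6, 7, 8}"
      using lengths[OF cyc[OF rs(2-4)]] lengths[OF cyc[OF rs(5-7)]] sum_ge unfolding lens by simp_all
    moreover have "length p + length q - 1 \<in> {3, 4, 5, 6, 7}"
      using pq(2,5) sum_ge by (simp only: insert_iff empty_iff) linarith
    moreover have "length r = 0 \<and> length s = 3 \<or> length r = 1 \<and> length s = 2
        \<or> length r = 2 \<and> length s = 1 \<or> length r = 3 \<and> length s = 0"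
      using rs(1) C(2) by linarith
    ultimately show False by auto
  qed
qed

end

section \<open>Moore-type counting in cubic graphs\<close>

locale cubic_adjacency = simple_adjacency E
  for E :: "'v \<Rightarrow> 'v \<Rightarrow> bool" +
  fixes V :: "'v set"
  assumes finite_V: "finite V"
    and adj_V: "E u v \<Longrightarrow> u \<in> V"
    and card_nbrs: "v \<in> V \<Longrightarrow> card {u. E v u} = 3"
begin

lemma adj_V': "E u v \<Longrightarrow> v \<in> V"
  using adj_V sym by blast

lemma finite_nbrs: "finite {u. E v u}"
  using finite_subset[OF _ finite_V] adj_V' by blast

lemma is_cycle_subset:
  assumes "is_cycle E cs"
  shows "set cs \<subseteq> V"
proof
  fix x assume "x \<in> set cs"
  then obtain as bs where "cs = as @ x # bs" by (meson split_list)
  then have "\<exists>y. E x y"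
    using assms by (cases bs) (auto simp: is_cycle_def successively_append_iff)
  then show "x \<in> V" using adj_V by blast
qed

lemma ball_subset: "w \<in> V \<Longrightarrow> ball u w n \<subseteq> V"
  by (induction n arbitrary: u w) (auto dest: adj_V')

text \<open>The balls are disjoint and miss \<open>w\<close>, so sizes add up. \<open>A\<close> is a
  parameter because an inner vertex has two onward neighbours, but the centre of a full ball has
  three.\<close>

lemma card_star:
  assumes girth: "\<And>cs. is_cycle E cs \<Longrightarrow> 2 * n + 3 \<le> length cs"
    and "A \<subseteq> {x. E w x}" "\<And>x. x \<in> A \<Longrightarrow> card (ball w x n) = k"
  shows "card (insert w (\<Union>x\<in>A. ball w x n)) = 1 + card A * k"
proof -
  have finA: "finite A" using assms(2) finite_nbrs by (rule finite_subset)
  have finball: "finite (ball w x n)" if "x \<in> A" for x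
  proof -
    have "x \<in> V" using assms(2) that adj_V' by blast
    then show ?thesis using finite_subset[OF ball_subset finite_V] by blast
  qed
  have "card (\<Union>x\<in>A. ball w x n) = (\<Sum>x\<in>A. card (ball w x n))"
  proof (intro card_UN_disjoint finA ballI impI finball)
    show "ball w x n \<inter> ball w x' n = {}" if "x \<in> A" "x' \<in> A" "x \<noteq> x'" for x x'
      using that assms(2) by (intro disjoint_balls[OF girth]) auto
  qed
  moreover have "w \<notin> (\<Union>x\<in>A. ball w x n)"
  proof
    assume "w \<in> (\<Union>x\<in>A. ball w x n)"
    then obtain x where "x \<in> A" "w \<in> ball w x n" by blast
    moreover have "n + 2 \<le> length cs" if "is_cycle E cs" for cs
      using girth[OF that] by simp
    ultimately show False using root_notin_ball[of n w x] assms(2) by blast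
  qed
  ultimately show ?thesis using finA finball assms(3) by simp
qed

lemma card_ball:
  assumes "\<And>cs. is_cycle E cs \<Longrightarrow> 2 * n < length cs" "E u w"
  shows "card (ball u w n) = 2 ^ Suc n - 1"
  using assms
proof (induction n arbitrary: u w)
  case (Suc n)
  let ?A = "{x. E w x \<and> x \<noteq> u}"
  have "?A = {x. E w x} - {u}" by auto
  then have A: "card ?A = 2" using card_nbrs[of w] adj_V' sym Suc.prems(2) by simp
  have "2 * n + 3 \<le> length cs" if "is_cycle E cs" for cs
    using Suc.prems(1)[OF that] by simp
  moreover have "card (ball w x n) = 2 ^ Suc n - 1" if "x \<in> ?A" for x
    using that Suc.prems(1) by (intro Suc.IH) fastforce+
  ultimately have "card (insert w (\<Union>x\<in>?A. ball w x n)) = 1 + card ?A * (2 ^ Suc n - 1)"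
    by (intro card_star) auto
  moreover have "1 + 2 * (2 ^ Suc n - 1) = 2 ^ Suc (Suc n) - (1::nat)"
    using one_le_power[of "2::nat" "Suc n"] unfolding power_Suc[of _ "Suc n"] by linarith
  ultimately show ?case using A by simp
qed simp

text \<open>A root with three binary trees of depth 3 has \<open>1 + 3 * 15 = 46\<close>
  vertices.\<close>

lemma card_ge_46_if_girth_ge_9:
  assumes "V \<noteq> {}" "\<And>cs. is_cycle E cs \<Longrightarrow> 9 \<le> length cs"
  shows "46 \<le> card V"
proof -
  obtain v where v: "v \<in> V" using assms(1) by blast
  have "card (ball v x 3) = 15" if "E v x" for x
  proof -
    have "2 * 3 < length cs" if "is_cycle E cs" for cs
      using assms(2)[OF that] by simp
    from card_ball[OF this that] show ?thesis by simp
  qed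
  then have "card (insert v (\<Union>x\<in>{x. E v x}. ball v x 3)) = 1 + card {x. E v x} * 15"
    using assms(2) by (intro card_star) auto
  moreover have "insert v (\<Union>x\<in>{x. E v x}. ball v x 3) \<subseteq> V"
    using v ball_subset adj_V' by blast
  ultimately have "1 + card {x. E v x} * 15 \<le> card V"
    using card_mono[OF finite_V] by metis
  then show ?thesis using card_nbrs[OF v] by simp
qed

lemma card_ge_40_if_five_cycle:
  assumes C: "is_cycle E cs" "length cs = 5"
    and lengths: "\<And>ds. is_cycle E ds \<Longrightarrow> length ds \<notin> {3, 4, 6, 7, 8}"
  shows "40 \<le> card V"
proof -
  \<comment> \<open>There will be just one neighbour off the 5-cycle, so \<open>R c\<close> is
    \<open>c\<close> together with a tree of 7 vertices.\<close>
  define R where "R c = insert c (\<Union>x\<in>{x. E c x \<and> x \<notin> set cs}. ball c x 2)" for c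
  have girth: "5 \<le> length ds" if "is_cycle E ds" for ds
    using lengths[OF that] that by (auto simp: is_cycle_def)
  have no3: "length ds \<noteq> 3" if "is_cycle E ds" for ds
    using girth[OF that] by simp
  have cardR: "card (R c) = 8" if c: "c \<in> set cs" for c
  proof -
    obtain x y where xy: "x \<noteq> y" "{u. E c u} \<inter> set cs = {x, y}"
      by (rule five_cycle_nbrs[OF C no3 c])
    have "c \<in> V" using xy adj_V by blast
    have "{x. E c x \<and> x \<notin> set cs} = {x. E c x} - {x, y}" using xy by blast
    moreover have "card ({x. E c x} - {x, y}) = card {x. E c x} - card {x, y}"
      using xy by (intro card_Diff_subset) auto
    ultimately have "card {x. E c x \<and> x \<notin> set cs} = 1"
      using card_nbrs[OF \<open>c \<in> V\<close>] xy(1) by simp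
    then obtain u where u: "{x. E c x \<and> x \<notin> set cs} = {u}" by (meson card_1_singletonE)
    then have "E c u" by blast
    have "card (ball c u 2) = 7"
      using card_ball[OF _ \<open>E c u\<close>, of 2] girth by fastforce
    moreover have "c \<notin> ball c u 2"
      using root_notin_ball[OF _ \<open>E c u\<close>, of 2] girth by fastforce
    moreover have "finite (ball c u 2)"
      using finite_subset[OF ball_subset finite_V] \<open>E c u\<close> adj_V' by blast
    ultimately show ?thesis unfolding R_def u by simp
  qed
  have branchR: "\<exists>p. branch E (set cs) p \<and> hd p = c \<and> last p = y" if c: "c \<in> set cs" and y: "y \<in> R c" for c y
  proof (cases "y = c")
    case True
    then have "branch E (set cs) [c]" using c by (simp add: branch_def)
    then show ?thesis using True by fastforce
  next
    case False
    then obtain x where x: "E c x" "x \<notin> set cs" "y \<in> ball c x 2" using y by (auto simp: R_def)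
    then obtain q where "nonbacktracking E (c # x # q)" "length q \<le> 2" "last (x # q) = y"
      using ball_walk by metis
    then have "branch E (set cs) (c # x # q) \<and> hd (c # x # q) = c \<and> last (c # x # q) = y"
      using c x by (simp add: branch_def)
    then show ?thesis by blast
  qed
  \<comment> \<open>A common vertex would end two branches with different roots.\<close>
  have disj: "R c \<inter> R d = {}" if cd: "c \<in> set cs" "d \<in> set cs" "c \<noteq> d" for c d
    using branchR[OF cd(1)] branchR[OF cd(2)] no_meeting_branches[OF C lengths] cd(3)
    by (metis disjoint_iff)
  have "R c \<subseteq> V" if c: "c \<in> set cs" for c
  proof -
    obtain x y where "{u. E c u} \<inter> set cs = {x, y}" by (rule five_cycle_nbrs[OF C no3 c])
    then have "E c x" by blast
    then show ?thesis using ball_subset adj_V adj_V' unfolding R_def by blast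
  qed
  then have "(\<Union>c\<in>set cs. R c) \<subseteq> V" by blast
  moreover have "card (\<Union>c\<in>set cs. R c) = (\<Sum>c\<in>set cs. card (R c))"
    using cardR disj by (intro card_UN_disjoint) (auto intro: card_ge_0_finite)
  moreover have "(\<Sum>c\<in>set cs. card (R c)) = 40"
    using C cardR by (simp add: is_cycle_def distinct_card)
  ultimately show ?thesis using card_mono[OF finite_V] by metis
qed

text \<open>The cycle lengths left over are 5 and those from 9 on, whence the case
  distinction.\<close>

theorem card_ge_40:
  assumes "V \<noteq> {}" "\<And>cs. is_cycle E cs \<Longrightarrow> length cs \<notin> {3, 4, 6, 7, 8}"
  shows "40 \<le> card V"
proof (cases "\<exists>cs. is_cycle E cs \<and> length cs = 5")
  case True
  then show ?thesis using card_ge_40_if_five_cycle assms(2) by blast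
next
  case False
  have "9 \<le> length cs" if "is_cycle E cs" for cs
  proof -
    have "length cs \<notin> {3, 4, 5, 6, 7, 8}" "3 \<le> length cs"
      using assms(2)[OF that] False that by (auto simp: is_cycle_def)
    then show ?thesis by simp
  qed
  from card_ge_46_if_girth_ge_9[OF assms(1) this] show ?thesis by simp
qed

end

subsection \<open>Contracting the triangles\<close>

locale claw_free_adjacency = cubic_adjacency +
  assumes claw_free: "\<lbrakk>E v a; E v b; E v c; a \<noteq> b; b \<noteq> c; a \<noteq> c\<rbrakk> \<Longrightarrow> E a b \<or> E b c \<or> E a c"
    and no_4_cycle: "is_cycle E cs \<Longrightarrow> length cs \<noteq> 4"
begin

lemma no_4_cycle': "\<lbrakk>E a b; E b c; E c d; E d a; a \<noteq> c; b \<noteq> d\<rbrakk> \<Longrightarrow> False"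
  using no_4_cycle[of "[a, b, c, d]"] irrefl by (auto simp: is_cycle_def)

text \<open>For \<open>v\<close> in \<open>V\<close> this is the unique triangle through
  \<open>v\<close>; describing it by common neighbours avoids a choice.\<close>

definition triangle :: "'a \<Rightarrow> 'a set" where
  "triangle v = {u. u = v \<or> E v u \<and> (\<exists>w. E v w \<and> E u w)}"

text \<open>These are the edges in no triangle, which become the edges of the contracted
  graph.\<close>

definition cross :: "'a \<Rightarrow> 'a \<Rightarrow> bool" where
  "cross u v \<longleftrightarrow> E u v \<and> \<not> (\<exists>w. E u w \<and> E v w)"

definition triangles :: "'a set set" where
  "triangles = triangle ` V"

definition triangle_adj :: "'a set \<Rightarrow> 'a set \<Rightarrow> bool" where
  "triangle_adj A B \<longleftrightarrow> A \<in> triangles \<and> B \<in> triangles \<and> (\<exists>a\<in>A. \<exists>b\<in>B. cross a b)"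

text \<open>Claw-freeness gives an edge between two neighbours \<open>a\<close> and \<open>b\<close>
  of \<open>v\<close>. An edge from the third neighbour \<open>c\<close> to either of them would
  create a 4-cycle through \<open>v\<close>.\<close>

lemma local_structure:
  assumes "v \<in> V"
  obtains a b c where "E v a" "E v b" "E a b" "a \<noteq> b" "triangle v = {v, a, b}"
    "\<And>x. cross v x \<longleftrightarrow> x = c"
proof -
  obtain x y z where N: "{u. E v u} = {x, y, z}" and ne: "x \<noteq> y" "y \<noteq> z" "x \<noteq> z"
    using card_nbrs[OF assms] by (auto simp: card_3_iff)
  have "E x y \<or> E y z \<or> E x z" using claw_free[of v x y z] N ne by blast
  then obtain a b c where N: "{u. E v u} = {a, b, c}" and ne: "a \<noteq> b" "b \<noteq> c" "a \<noteq> c" and "E a b"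
    using N ne by (smt (verit) insert_commute)
  then have v: "E v a" "E v b" "E v c" by blast+
  have "\<not> E a c" "\<not> E b c"
    using no_4_cycle'[of v c a b] no_4_cycle'[of v c b a] v \<open>E a b\<close> ne sym irrefl by metis+
  have nbr: "x = a \<or> x = b \<or> x = c" if "E v x" for x using N that by blast
  have "triangle v = {v, a, b}"
    unfolding triangle_def using v nbr \<open>E a b\<close> \<open>\<not> E a c\<close> \<open>\<not> E b c\<close> irrefl sym by blast
  moreover have "cross v x \<longleftrightarrow> x = c" for x
    unfolding cross_def using v nbr \<open>E a b\<close> \<open>\<not> E a c\<close> \<open>\<not> E b c\<close> irrefl sym by blast
  ultimately show ?thesis using that v \<open>E a b\<close> ne(1) by blast
qed

lemma card_triangle:
  assumes "v \<in> V"
  shows "card (triangle v) = 3"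
proof (rule local_structure[OF assms])
  fix a b assume "E v a" "E v b" "a \<noteq> b" "triangle v = {v, a, b}"
  moreover from this have "v \<noteq> a" "v \<noteq> b" using irrefl by blast+
  ultimately show ?thesis by simp
qed

lemma triangle_self: "v \<in> triangle v"
  by (simp add: triangle_def)

text \<open>One inclusion is clear, and both sets have three elements.\<close>

lemma triangle_eqI:
  assumes "E x y" "E y z" "E x z"
  shows "triangle x = {x, y, z}"
proof -
  have "{x, y, z} \<subseteq> triangle x" using assms sym by (auto simp: triangle_def)
  moreover have "x \<noteq> y" "y \<noteq> z" "x \<noteq> z" using assms irrefl by blast+
  then have "card {x, y, z} = 3" by simp
  moreover have "card (triangle x) = 3" using card_triangle adj_V assms(1) by blast
  ultimately show ?thesis by (metis card_ge_0_finite card_subset_eq zero_less_numeral)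
qed

lemma triangle_eq:
  assumes "v \<in> V" "u \<in> triangle v"
  shows "triangle u = triangle v"
proof (rule local_structure[OF assms(1)])
  fix a b assume "E v a" "E v b" "E a b" "triangle v = {v, a, b}"
  moreover from this have "triangle a = {a, v, b}" "triangle b = {b, v, a}"
    using sym by (intro triangle_eqI; blast)+
  ultimately show ?thesis using assms(2) by auto
qed

lemma triangle_adjacent:
  assumes "v \<in> V" "u \<in> triangle v" "w \<in> triangle v" "u \<noteq> w"
  shows "E u w"
proof (rule local_structure[OF assms(1)])
  fix a b assume "E v a" "E v b" "E a b" "triangle v = {v, a, b}"
  moreover from this have "E a v" "E b v" "E b a" using sym by blast+
  ultimately show ?thesis using assms(2-) by auto
qed

lemma triangle_subset: "v \<in> V \<Longrightarrow> triangle v \<subseteq> V"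
  by (auto simp: triangle_def dest: adj_V')

lemma triangles_eq: "A \<in> triangles \<Longrightarrow> u \<in> A \<Longrightarrow> u \<in> V \<and> A = triangle u"
  unfolding triangles_def using triangle_subset triangle_eq by blast

lemma triangles_adjacent: "\<lbrakk>A \<in> triangles; u \<in> A; w \<in> A; u \<noteq> w\<rbrakk> \<Longrightarrow> E u w"
  unfolding triangles_def using triangle_adjacent by blast

lemma cross_sym: "cross u v \<Longrightarrow> cross v u"
  unfolding cross_def using sym by blast

lemma cross_unique: "cross u v \<Longrightarrow> cross u w \<Longrightarrow> v = w"
  using local_structure[of u] adj_V unfolding cross_def by metis

lemma cross_exists: "v \<in> V \<Longrightarrow> \<exists>u. cross v u"
  using local_structure[of v] by metis

lemma cross_leaves_triangle:
  assumes "cross u v" "A \<in> triangles" "u \<in> A"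
  shows "v \<notin> A"
proof
  assume "v \<in> A"
  then have "v \<in> triangle u" using triangles_eq assms by blast
  then show False using assms(1) irrefl by (auto simp: cross_def triangle_def)
qed

lemma card_V: "card V = 3 * card triangles"
proof -
  have "\<Union> triangles = V"
    unfolding triangles_def using triangle_subset triangle_self by blast
  moreover have "3 * card triangles = card (\<Union> triangles)"
  proof (rule card_partition)
    show "finite triangles" "finite (\<Union> triangles)"
      using finite_V \<open>\<Union> triangles = V\<close> by (auto simp: triangles_def)
    show "card A = 3" if "A \<in> triangles" for A
      using that card_triangle by (auto simp: triangles_def)
    show "A \<inter> B = {}" if "A \<in> triangles" "B \<in> triangles" "A \<noteq> B" for A B
      using that triangles_eq by blast
  qed
  ultimately show ?thesis by simp
qed

section \<open>The contracted graph and lifting its cycles\<close>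

text \<open>Each of the three vertices of a triangle has one cross edge. These edges leave the
  triangle and lead to three different ones.\<close>

lemma cubic_triangle_adj: "cubic_adjacency triangle_adj triangles"
proof
  show "triangle_adj B A" if "triangle_adj A B" for A B
    using that cross_sym unfolding triangle_adj_def by blast
  show "\<not> triangle_adj A A" for A
    using cross_leaves_triangle unfolding triangle_adj_def by blast
  show "finite triangles" using finite_V by (simp add: triangles_def)
  show "A \<in> triangles" if "triangle_adj A B" for A B
    using that by (simp add: triangle_adj_def)
  show "card {B. triangle_adj A B} = 3" if A: "A \<in> triangles" for A
  proof -
    obtain f where f: "cross x (f x)" if "x \<in> V" for x using cross_exists by metis
    have AV: "x \<in> V" if "x \<in> A" for x using triangles_eq[OF A that] by blast
    have fV: "f x \<in> V" if "x \<in> A" for x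
      using f[OF AV[OF that]] adj_V' unfolding cross_def by blast
    have "{B. triangle_adj A B} = (\<lambda>x. triangle (f x)) ` A"
    proof (intro equalityI subsetI)
      fix B assume "B \<in> {B. triangle_adj A B}"
      then obtain a b where ab: "a \<in> A" "b \<in> B" "cross a b" and "B \<in> triangles"
        by (auto simp: triangle_adj_def)
      then have "b = f a" using cross_unique f AV by blast
      then have "B = triangle (f a)" using triangles_eq \<open>B \<in> triangles\<close> ab(2) by blast
      then show "B \<in> (\<lambda>x. triangle (f x)) ` A" using ab(1) by blast
    next
      fix B assume "B \<in> (\<lambda>x. triangle (f x)) ` A"
      then obtain x where "x \<in> A" "B = triangle (f x)" by blast
      then show "B \<in> {B. triangle_adj A B}"
        using A f[OF AV] fV triangle_self unfolding triangle_adj_def triangles_def by blast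
    qed
    \<comment> \<open>Two cross edges between the same pair of triangles would form a 4-cycle with
      one edge of each triangle.\<close>
    moreover have "inj_on (\<lambda>x. triangle (f x)) A"
    proof (rule inj_onI, rule ccontr)
      fix x y assume xy: "x \<in> A" "y \<in> A" "triangle (f x) = triangle (f y)" "x \<noteq> y"
      have fxy: "cross x (f x)" "cross y (f y)" using f AV xy(1,2) by blast+
      then have "f x \<noteq> f y" using xy(4) cross_unique cross_sym by metis
      then have "E (f x) (f y)"
        using triangle_adjacent[OF fV[OF xy(1)]] triangle_self xy(3) by metis
      moreover have "E x y" using triangles_adjacent A xy by blast
      moreover have "f y \<noteq> x" "f x \<noteq> y" using cross_leaves_triangle[OF _ A] fxy xy(1,2) by metis+
      moreover have "E x (f x)" "E y (f y)" using fxy by (auto simp: cross_def)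
      ultimately show False using no_4_cycle'[of x y "f y" "f x"] sym by blast
    qed
    moreover have "card A = 3" using A card_triangle by (auto simp: triangles_def)
    ultimately show ?thesis by (simp add: card_image)
  qed
qed

text \<open>Here \<open>m\<close> is the number of triangles that are passed along two edges.\<close>
lemma lift_path:
  assumes "nonbacktracking triangle_adj (B # As @ [D])" "distinct As" "As \<noteq> []" "m \<le> length As"
    and "cross u x" "u \<in> B" "x \<in> hd As" "cross y w" "y \<in> last As" "w \<in> D"
    and "set As \<subseteq> triangles"
  shows "\<exists>q. q \<noteq> [] \<and> hd q = x \<and> last q = y \<and> distinct q \<and> successively E q \<and> set q \<subseteq> \<Union> (set As)
           \<and> length q = 2 * length As + m"
  using assms
proof (induction As arbitrary: B u x m)
  case (Cons A As)
  \<comment> \<open>The route enters \<open>A\<close> at \<open>x\<close> and leaves it at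
    \<open>y'\<close>; \<open>j\<close> says whether the third vertex is visited in between.\<close>
  have segment: "\<exists>s. s \<noteq> [] \<and> hd s = x \<and> last s = y' \<and> distinct s \<and> successively E s \<and> set s \<subseteq> A
      \<and> length s = 2 + j"
    if C: "triangle_adj A C" "B \<noteq> C" and "y' \<in> A" "cross y' w'" "w' \<in> C" "j \<le> 1" for y' w' j C
  proof -
    have "triangle_adj B A" using Cons.prems(1) by (cases As) auto
    then have "A \<in> triangles" "B \<in> triangles" "C \<in> triangles"
      using C by (auto simp: triangle_adj_def)
    have "x \<in> A" using Cons.prems by simp
    \<comment> \<open>Otherwise the only cross edge at \<open>x\<close> would lead back to
      \<open>B\<close>, against \<open>B \<noteq> C\<close>.\<close>
    have "x \<noteq> y'"
    proof
      assume "x = y'"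
      then have "u = w'" using cross_unique cross_sym that(4) Cons.prems(5) by blast
      then show False
        using triangles_eq \<open>B \<in> triangles\<close> \<open>C \<in> triangles\<close> Cons.prems(6) that(2,5) by metis
    qed
    have "card (A - {x, y'}) = 1"
      using card_triangle \<open>A \<in> triangles\<close> \<open>x \<in> A\<close> that(3) \<open>x \<noteq> y'\<close>
      by (subst card_Diff_subset) (auto simp: triangles_def)
    then obtain z where "z \<in> A" "z \<noteq> x" "z \<noteq> y'"
      by (metis DiffE card_1_singletonE insertCI)
    then have "E x z" "E z y'" "E x y'"
      using triangles_adjacent \<open>A \<in> triangles\<close> \<open>x \<in> A\<close> that(3) \<open>x \<noteq> y'\<close> by metis+
    then show ?thesis
      using \<open>x \<in> A\<close> \<open>z \<in> A\<close> that(3,6) \<open>x \<noteq> y'\<close> \<open>z \<noteq> x\<close> \<open>z \<noteq> y'\<close>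
      by (cases "j = 0") (auto intro: exI[of _ "[x, y']"] exI[of _ "[x, z, y']"])
  qed
  show ?case
  proof (cases "As = []")
    case True
    then have "triangle_adj A D" "B \<noteq> D" using Cons.prems(1) by auto
    from segment[OF this _ Cons.prems(8,10), of m] show ?thesis
      using True Cons.prems(4,9) by simp
  next
    case False
    then obtain A' As' where As: "As = A' # As'" by (cases As) auto
    then have nb: "nonbacktracking triangle_adj (A # As @ [D])" and "B \<noteq> A'"
      using Cons.prems(1) by simp_all
    then have A': "triangle_adj A A'" "B \<noteq> A'" using As by (cases As'; simp)+
    obtain y' x' where x': "y' \<in> A" "x' \<in> A'" "cross y' x'"
      using A'(1) by (auto simp: triangle_adj_def)
    \<comment> \<open>Detours are spent greedily: this triangle takes one if any is left.\<close>
    define j where "j = min m 1"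
    obtain s where s: "s \<noteq> []" "hd s = x" "last s = y'" "distinct s" "successively E s" "set s \<subseteq> A"
      "length s = 2 + j"
      using segment[OF A' x'(1,3,2), of j] by (auto simp: j_def)
    have "m - j \<le> length As" using Cons.prems(4) by (auto simp: j_def)
    then obtain q where q: "q \<noteq> []" "hd q = x'" "last q = y" "distinct q" "successively E q"
      "set q \<subseteq> \<Union> (set As)" "length q = 2 * length As + (m - j)"
    proof -
      have "distinct As" "set As \<subseteq> triangles" "x' \<in> hd As" "y \<in> last As"
        using Cons.prems(2,9,11) x'(2) As by auto
      from Cons.IH[OF nb this(1) False \<open>m - j \<le> length As\<close> x'(3,1) this(3) Cons.prems(8) this(4)
          Cons.prems(10) this(2)]
      show ?thesis using that by blast
    qed
    have "A \<inter> C = {}" if "C \<in> set As" for C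
    proof -
      have "A \<in> triangles" "C \<in> triangles" "A \<noteq> C" using Cons.prems(2,11) that by auto
      then show ?thesis using triangles_eq by blast
    qed
    then have "A \<inter> \<Union> (set As) = {}" by blast
    then have "distinct (s @ q)" using s q by auto
    moreover have "successively E (s @ q)"
      using s q x'(3) by (auto simp: successively_append_iff cross_def)
    moreover have "length (s @ q) = 2 * length (A # As) + m"
      using s(7) q(7) by (simp add: j_def)
    moreover have "set (s @ q) \<subseteq> \<Union> (set (A # As))" using s(6) q(6) by auto
    ultimately show ?thesis using s q by (intro exI[of _ "s @ q"]) auto
  qed
qed simp

text \<open>One cross edge from the last triangle to the first serves both as entrance and as exit
  of the lifted path, and closes it.\<close>

lemma lift_cycle:
  assumes "is_cycle triangle_adj As" "m \<le> length As"
  shows "\<exists>cs. is_cycle E cs \<and> length cs = 2 * length As + m"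
proof -
  have As: "triangle_adj (last As) (hd As)" "As \<noteq> []" "distinct As" "3 \<le> length As"
    using assms(1) by (auto simp: is_cycle_def)
  then obtain y x where yx: "y \<in> last As" "x \<in> hd As" "cross y x" by (auto simp: triangle_adj_def)
  from lift_path[OF nonbacktracking_closed[OF assms(1)] As(3,2) assms(2) yx(3,1,2,3,1,2)]
    cubic_adjacency.is_cycle_subset[OF cubic_triangle_adj assms(1)]
  obtain q where q: "q \<noteq> []" "hd q = x" "last q = y" "distinct q" "successively E q"
    "length q = 2 * length As + m" by blast
  then have "is_cycle E q" using yx(3) As(4) by (simp add: is_cycle_def cross_def)
  then show ?thesis using q(6) by blast
qed

theorem card_ge_120:
  assumes "V \<noteq> {}" "\<And>cs. is_cycle E cs \<Longrightarrow> length cs \<noteq> 8 \<and> length cs \<noteq> 16"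
  shows "120 \<le> card V"
proof -
  interpret H: cubic_adjacency triangle_adj triangles by (rule cubic_triangle_adj)
  have "length As \<notin> {3, 4, 6, 7, 8}" if "is_cycle triangle_adj As" for As
  proof -
    have "2 * length As + m \<noteq> 8 \<and> 2 * length As + m \<noteq> 16" if "m \<le> length As" for m
      using lift_cycle[OF \<open>is_cycle triangle_adj As\<close> that] assms(2) by metis
    \<comment> \<open>No detours exclude the lengths 4 and 8, two exclude 3 and 7, and four exclude
      6. A 5-cycle lifts only to lengths 10 to 15, so it survives.\<close>
    from this[of 0] this[of 2] this[of 4] show ?thesis by auto
  qed
  then have "40 \<le> card triangles"
    using assms(1) by (intro H.card_ge_40) (auto simp: triangles_def)
  then show ?thesis using card_V by simp
qed

end

subsection \<open>Symmetric digraphs\<close>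

context graph
begin

lemma awalk_along:
  assumes "successively (\<lambda>u v. u \<rightarrow>\<^bsub>G\<^esub> v) (u # xs)" "u \<in> verts G"
  shows "\<exists>p. awalk u p (last (u # xs)) \<and> awalk_verts u p = u # xs"
  using assms
proof (induction xs arbitrary: u)
  case Nil
  then show ?case by (intro exI[of _ "[]"]) (simp add: awalk_Nil_iff)
next
  case (Cons v xs)
  then have "u \<rightarrow>\<^bsub>G\<^esub> v" "v \<in> verts G" by (auto dest: adj_in_verts)
  then obtain e where e: "e \<in> arcs G" "tail G e = u" "head G e = v" by blast
  obtain p where "awalk v p (last (v # xs))" "awalk_verts v p = v # xs"
    using Cons.IH[of v] Cons.prems(1) \<open>v \<in> verts G\<close> by auto
  then show ?case using e by (intro exI[of _ "e # p"]) (auto simp: awalk_Cons_iff)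
qed

text \<open>Repeating the first vertex at the end yields a closed walk with one arc per vertex of
  the list.\<close>

lemma undirected_cycle_if_is_cycle:
  assumes "is_cycle (\<lambda>u v. u \<rightarrow>\<^bsub>G\<^esub> v) cs"
  shows "\<exists>p. undirected_cycle G p \<and> length p = length cs"
proof -
  obtain c cs' where cs: "cs = c # cs'" using assms by (cases cs) (auto simp: is_cycle_def)
  have "successively (\<lambda>u v. u \<rightarrow>\<^bsub>G\<^esub> v) (c # cs' @ [c])"
    using assms unfolding is_cycle_def cs
    by (auto simp: successively_append_iff successively_Cons hd_append split: if_splits)
  moreover have "c \<in> verts G"
    using assms adj_in_verts(2) by (auto simp: is_cycle_def cs)
  ultimately obtain p where p: "awalk c p (last (c # cs' @ [c]))" "awalk_verts c p = c # cs' @ [c]"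
    using awalk_along by blast
  have "length p = length cs" using length_awalk_verts[of c p] p(2) cs by simp
  moreover have "cycle p"
    unfolding cycle_def using p assms calculation by (intro exI[of _ c]) (auto simp: is_cycle_def cs)
  ultimately show ?thesis using assms by (auto simp: undirected_cycle_def is_cycle_def)
qed

text \<open>Without parallel arcs, \<open>head G\<close> is injective on the arcs leaving
  \<open>v\<close>.\<close>

lemma out_degree_eq_card_nbrs: "out_degree G v = card {u. v \<rightarrow>\<^bsub>G\<^esub> u}"
proof -
  have "bij_betw (head G) (out_arcs G v) {u. v \<rightarrow>\<^bsub>G\<^esub> u}"
    unfolding bij_betw_def
  proof
    show "inj_on (head G) (out_arcs G v)"
      by (rule inj_onI, rule no_multi_arcs) (auto simp: arc_to_ends_def)
    show "head G ` out_arcs G v = {u. v \<rightarrow>\<^bsub>G\<^esub> u}"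
      by (auto simp: arcs_ends_conv)
  qed
  then show ?thesis unfolding out_degree_def by (rule bij_betw_same_card)
qed

text \<open>Otherwise the four vertices would induce a claw with centre \<open>v\<close>.\<close>

lemma claw_freeD:
  assumes "claw_free G" and v: "v \<rightarrow>\<^bsub>G\<^esub> a" "v \<rightarrow>\<^bsub>G\<^esub> b" "v \<rightarrow>\<^bsub>G\<^esub> c"
    and ne: "a \<noteq> b" "b \<noteq> c" "a \<noteq> c"
  shows "a \<rightarrow>\<^bsub>G\<^esub> b \<or> b \<rightarrow>\<^bsub>G\<^esub> c \<or> a \<rightarrow>\<^bsub>G\<^esub> c"
proof (rule ccontr)
  assume no: "\<not> (a \<rightarrow>\<^bsub>G\<^esub> b \<or> b \<rightarrow>\<^bsub>G\<^esub> c \<or> a \<rightarrow>\<^bsub>G\<^esub> c)"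
  let ?S = "{v, a, b, c}"
  let ?H = "G \<restriction> ?S"
  have sym: "y \<rightarrow>\<^bsub>G\<^esub> x" if "x \<rightarrow>\<^bsub>G\<^esub> y" for x y
    using that by (rule graph_symmetric)
  have S: "?S \<subseteq> verts G" using v adj_in_verts by blast
  have ends: "arcs_ends ?H = {(x, y). x \<rightarrow>\<^bsub>G\<^esub> y \<and> x \<in> ?S \<and> y \<in> ?S}"
    by (auto simp: arcs_ends_conv)
  interpret H: wf_digraph ?H by (rule wellformed_induce_subgraph)
  have "symmetric ?H"
    unfolding symmetric_def ends sym_def using sym by blast
  then have "graph ?H"
    by unfold_locales
      (auto simp: no_loops arc_to_ends_def intro: no_multi_arcs)
  moreover have "arcs_ends ?H = {v} \<times> {a, b, c} \<union> {a, b, c} \<times> {v}"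
    unfolding ends using v v[THEN sym] no sym adj_not_same by blast
  moreover have "v \<notin> {a, b, c}" using v adj_not_same by blast
  ultimately have "graph ?H" "{v} \<inter> {a, b, c} = {}" "card {a, b, c} = 3"
    "arcs_ends ?H = {v} \<times> {a, b, c} \<union> {a, b, c} \<times> {v}"
    using ne by simp_all
  moreover have "verts ?H = {v} \<union> {a, b, c}" "card {v} = 1" by auto
  ultimately have "complete_bipartite_digraph 1 3 ?H"
    unfolding complete_bipartite_digraph_def by blast
  moreover have "induced_subgraph ?H G" using S by (rule induced_induce)
  ultimately show False using assms(1) unfolding claw_free_def by blast
qed

end

theorem theorem9:
  fixes G :: "('a, 'b) pre_digraph"
  assumes "graph G"
    and "verts G \<noteq> {}"
    and "cubic G"
    and "claw_free G"
  shows "(card (verts G) < 114 \<longrightarrow> has_power_of_2_cycle G) \<and>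
         (erdos_gyarfas_counterexample G \<longrightarrow> 114 \<le> card (verts G))"
proof -
  interpret graph G by fact
  \<comment> \<open>Both conjuncts follow: the first by contraposition, the second because a
    counterexample has no such cycle.\<close>
  have "114 \<le> card (verts G)" if no: "\<not> has_power_of_2_cycle G"
  proof -
    have no_cycle: "length cs \<noteq> 2 ^ k" if "is_cycle (\<lambda>u v. u \<rightarrow>\<^bsub>G\<^esub> v) cs" for cs k
      using no undirected_cycle_if_is_cycle[OF that] unfolding has_power_of_2_cycle_def by metis
    interpret claw_free_adjacency "\<lambda>u v. u \<rightarrow>\<^bsub>G\<^esub> v" "verts G"
    proof
      show "card {u. v \<rightarrow>\<^bsub>G\<^esub> u} = 3" if "v \<in> verts G" for v
        using assms(3) that by (simp add: cubic_def out_degree_eq_card_nbrs)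
      show "length cs \<noteq> 4" if "is_cycle (\<lambda>u v. u \<rightarrow>\<^bsub>G\<^esub> v) cs" for cs
        using no_cycle[OF that, of 2] by simp
      show "v \<rightarrow>\<^bsub>G\<^esub> u" if "u \<rightarrow>\<^bsub>G\<^esub> v" for u v
        using that by (rule graph_symmetric)
      show "\<not> v \<rightarrow>\<^bsub>G\<^esub> v" for v
        using adj_not_same by blast
      show "u \<in> verts G" if "u \<rightarrow>\<^bsub>G\<^esub> v" for u v
        using that by (rule adj_in_verts)
    qed (use claw_freeD[OF assms(4)] in \<open>simp_all only: finite_verts\<close>)
    \<comment> \<open>Of all powers of 2, only 4, 8 and 16 enter the argument.\<close>
    have "length cs \<noteq> 8 \<and> length cs \<noteq> 16" if "is_cycle (\<lambda>u v. u \<rightarrow>\<^bsub>G\<^esub> v) cs" for cs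
      using no_cycle[OF that, of 3] no_cycle[OF that, of 4] by simp
    then show ?thesis using card_ge_120[OF assms(2)] by force
  qed
  then show ?thesis unfolding erdos_gyarfas_counterexample_def by (meson not_le)
qed

end
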